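(* Fix an integer $k\ge1$. For $n\ge1$ let $P^{(1)}$ be the $n\times n$ matrix with entries \[ a(i,j,n)=\frac{1}{2^i}\binom{i-1}{j-1}+\frac{1}{2^{n-i+1}}\binom{n-i}{j-i}\qquad(1\le i,j\le n), \] with $\binom{a}{b}=0$ if $b<0$ or $b>a$, and let $a^{(k)}_{i,j}$ be the $(i,j)$ entry of $(P^{(1)})^k$. Let \[ E_n=\sum_{i=1}^n\max_{1\le j\le n}a^{(k)}_{i,j}, \] the expected number of correct guesses under the optimal no-feedback guessing strategy for an $n$-card deck after $k$ riffle shuffles. Then, as $n\to\infty$, \[ E_n=\frac{2\sqrt n}{\sqrt{(2^k-1)\pi}}+\mathcal O(1). \]
   Context: A deck of $n$ cards ordered $1,2,\dots,n$ is given $k$ riffle (GSR) shuffles; $a^{(k)}_{i,j}$ is the probability that the card at position $i$ is card number $j$. In the no-feedback game the player fixes a guess for every position in advance and scores one point per correct guess; the optimal strategy guesses, at each position $i$, a $j$ maximizing $a^{(k)}_{i,j}$, so its expected score is $E_n$. *)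

theory Defs
  imports Complex_Main "HOL-Library.Landau_Symbols" "Jordan_Normal_Form.Matrix"
begin

text \<open>Positions and cards are numbered from 1. The \<open>if\<close> implements the convention that
  a binomial coefficient with negative lower index is 0, since subtraction on
  \<^typ>\<open>nat\<close> truncates.\<close>

definition riffle_entry :: "nat \<Rightarrow> nat \<Rightarrow> nat \<Rightarrow> real" where
  "riffle_entry i j n =
     1 / 2 ^ i * real ((i - 1) choose (j - 1))
     + 1 / 2 ^ (n - i + 1) * (if i \<le> j then real ((n - i) choose (j - i)) else 0)"

text \<open>Matrix indices are 0-based, hence the shifts in the next two definitions.\<close>

definition riffle_mat :: "nat \<Rightarrow> real mat" where
  "riffle_mat n = mat n n (\<lambda>(r, c). riffle_entry (r + 1) (c + 1) n)"

definition riffle_prob :: "nat \<Rightarrow> nat \<Rightarrow> nat \<Rightarrow> nat \<Rightarrow> real" where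
  "riffle_prob k n i j = (riffle_mat n ^\<^sub>m k) $$ (i - 1, j - 1)"

definition expected_score :: "nat \<Rightarrow> nat \<Rightarrow> real" where
  "expected_score k n = (\<Sum>i = 1..n. Max ((\<lambda>j. riffle_prob k n i j) ` {1..n}))"

end

theory Submission
  imports Defs "HOL-Analysis.Analysis" "HOL-Real_Asymp.Real_Asymp"
    "HOL-Computational_Algebra.Polynomial"
begin

text \<open>
  Put \<open>a = 2^k\<close>. Row \<open>r\<close> of the matrix power is the uniform mixture over \<open>d < a\<close> of the laws of
  \<open>Bin(r, (d+1)/a) + Bin(n-1-r, d/a)\<close>. The means of neighbouring components differ by
  \<open>(n-1)/a\<close>, so by a Chernoff bound at most one component contributes more than \<open>O(1/n)\<close> to any
  given entry. With \<open>m = min r (n-1-r)\<close>, every component has point masses at most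
  \<open>a / sqrt (2 \<pi> (a-1) m) + O(m^(-3/2))\<close>, by Stirling's formula at the mode of a binomial law,
  and the component \<open>d = 0\<close> or \<open>d = a-1\<close> attains this up to the error. Hence the row maximum is
  \<open>1 / sqrt (2 \<pi> (a-1) m)\<close> up to errors whose sum over all rows is bounded, and summing the
  main term over \<open>r\<close> gives \<open>2 sqrt n / sqrt ((a-1) \<pi>)\<close>.
\<close>

section \<open>Stirling's formula with error bounds\<close>

definition stirling_diff :: "nat \<Rightarrow> real" where
  "stirling_diff n = ln (fact n) - (real n + 1/2) * ln (real n) + real n"

text \<open>The derivative of the difference is a square over a positive quantity. This approximant
  is chosen because its product with \<open>1 / y + 1/2\<close> is exactly 1, which makes
  \<open>stirling_diff\<close> decreasing.\<close>

lemma ln_one_plus_ge_ratio: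
  fixes y :: real
  assumes "0 \<le> y"
  shows "2 * y / (2 + y) \<le> ln (1 + y)"
proof -
  have "(\<lambda>t::real. ln (1 + t) - 2 * t / (2 + t)) 0 \<le> (\<lambda>t. ln (1 + t) - 2 * t / (2 + t)) y"
  proof (rule DERIV_nonneg_imp_nondecreasing[OF assms])
    fix x :: real assume x: "0 \<le> x" "x \<le> y"
    have "((\<lambda>t::real. ln (1 + t) - 2 * t / (2 + t)) has_real_derivative
            1 / (1 + x) - 4 / (2 + x)\<^sup>2) (at x)"
      using x by (auto intro!: derivative_eq_intros simp: power2_eq_square)
    also have "1 / (1 + x) - 4 / (2 + x)\<^sup>2 = x\<^sup>2 / ((1 + x) * (2 + x)\<^sup>2)"
      using x by (simp add: divide_simps) (simp add: algebra_simps power2_eq_square)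
    finally have "((\<lambda>t::real. ln (1 + t) - 2 * t / (2 + t)) has_real_derivative
            x\<^sup>2 / ((1 + x) * (2 + x)\<^sup>2)) (at x)" .
    thus "\<exists>d. ((\<lambda>t::real. ln (1 + t) - 2 * t / (2 + t)) has_real_derivative d) (at x) \<and> 0 \<le> d"
      using x by (intro exI[of _ "x\<^sup>2 / ((1 + x) * (2 + x)\<^sup>2)"] conjI) auto
  qed
  thus ?thesis by simp
qed

text \<open>The difference has derivative \<open>x^3 / (1 + x)\<close>. Third order suffices: after
  multiplication by \<open>1 / y + 1/2\<close> the terms linear in \<open>y\<close> cancel, and the
  excess over 1 is of order \<open>y^2\<close>.\<close>

lemma ln_one_plus_le_cubic:
  fixes y :: real
  assumes "0 \<le> y"
  shows "ln (1 + y) \<le> y - y^2 / 2 + y^3 / 3"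
proof -
  have "(\<lambda>t::real. t - t^2 / 2 + t^3 / 3 - ln (1 + t)) 0 \<le> (\<lambda>t. t - t^2 / 2 + t^3 / 3 - ln (1 + t)) y"
  proof (rule DERIV_nonneg_imp_nondecreasing[OF assms])
    fix x :: real assume x: "0 \<le> x" "x \<le> y"
    have "((\<lambda>t::real. t - t^2 / 2 + t^3 / 3 - ln (1 + t)) has_real_derivative 1 - x + x^2 - 1 / (1 + x)) (at x)"
      using x by (auto intro!: derivative_eq_intros)
    also have "1 - x + x^2 - 1 / (1 + x) = x^3 / (1 + x)"
      using x by (simp add: field_simps power2_eq_square power3_eq_cube)
    finally have "((\<lambda>t::real. t - t^2 / 2 + t^3 / 3 - ln (1 + t)) has_real_derivative x^3 / (1 + x)) (at x)" .
    thus "\<exists>d. ((\<lambda>t::real. t - t^2 / 2 + t^3 / 3 - ln (1 + t)) has_real_derivative d) (at x) \<and> 0 \<le> d"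
      using x by (intro exI[of _ "x^3 / (1 + x)"] conjI) auto
  qed
  thus ?thesis by simp
qed

text \<open>With \<open>y = 1 / n\<close> the decrease equals
  \<open>(n + 1/2) * ln (1 + y) - 1\<close>. Its upper bound telescopes, so the total decrease from
  \<open>n\<close> onwards is at most \<open>1 / n\<close>.\<close>

lemma stirling_diff_step:
  assumes "n \<ge> 1"
  shows "stirling_diff (Suc n) \<le> stirling_diff n"
    and "stirling_diff n - stirling_diff (Suc n) \<le> 1 / real n - 1 / real (Suc n)"
proof -
  define y where "y = 1 / real n"
  have y: "0 < y" "y \<le> 1" and n: "real n = 1 / y"
    using assms by (auto simp: y_def)
  have "real (Suc n) = real n * (1 + y)"
    using assms by (simp add: y_def field_simps)
  hence "ln (real (Suc n)) = ln (real n) + ln (1 + y)"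
    using assms y by (simp add: ln_mult del: of_nat_Suc)
  moreover have "ln (fact (Suc n)) = ln (real (Suc n)) + ln (fact n :: real)"
    by (simp add: ln_mult)
  ultimately have diff: "stirling_diff n - stirling_diff (Suc n) = (real n + 1/2) * ln (1 + y) - 1"
    by (simp add: stirling_diff_def algebra_simps)
  have "(1 / y + 1/2) * (2 * y / (2 + y)) = 1"
    using y by (simp add: divide_simps)
  moreover have "(1 / y + 1/2) * (2 * y / (2 + y)) \<le> (1 / y + 1/2) * ln (1 + y)"
    using y by (intro mult_left_mono ln_one_plus_ge_ratio) auto
  ultimately have "0 \<le> (real n + 1/2) * ln (1 + y) - 1"
    unfolding n by linarith
  thus "stirling_diff (Suc n) \<le> stirling_diff n"
    unfolding diff [symmetric] by simp
  have "(1 / y + 1/2) * ln (1 + y) \<le> (1 / y + 1/2) * (y - y^2 / 2 + y^3 / 3)"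
    using y by (intro mult_left_mono ln_one_plus_le_cubic) auto
  also have "\<dots> = 1 + y^2 * (1/12 + y/6)"
    using y by (simp add: field_simps power2_eq_square power3_eq_cube)
  \<comment> \<open>This step and the next use \<open>y \<le> 1\<close>; the sharper constant 1/12
    is given up to reach the telescoping form \<open>y^2 / (1 + y)\<close>.\<close>
  also have "\<dots> \<le> 1 + y^2 * (1/4)"
    using y by (intro add_left_mono mult_left_mono) auto
  also have "\<dots> \<le> 1 + y^2 / (1 + y)"
    using y by (auto simp: field_simps)
  also have "y^2 / (1 + y) = 1 / real n - 1 / real (Suc n)"
    using y by (simp add: n field_simps power2_eq_square)
  finally show "stirling_diff n - stirling_diff (Suc n) \<le> 1 / real n - 1 / real (Suc n)"
    using diff n by simp
qed

text \<open>From 1 on, \<open>stirling_diff n\<close> decreases while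
  \<open>stirling_diff n - 1 / n\<close> increases. Both have the same limit \<open>c\<close>, which
  therefore lies between them.\<close>

lemma stirling_diff_convergent:
  obtains c where "stirling_diff \<longlonglongrightarrow> c"
    "\<And>n. n \<ge> 1 \<Longrightarrow> c \<le> stirling_diff n" "\<And>n. n \<ge> 1 \<Longrightarrow> stirling_diff n \<le> c + 1 / real n"
proof -
  \<comment> \<open>The shift makes the sequences start at 1, where the step inequalities begin to
    hold.\<close>
  define X where "X n = stirling_diff (Suc n)" for n
  define Y where "Y n = X n - 1 / real (Suc n)" for n
  have dec: "decseq X"
    by (intro decseq_SucI) (simp add: X_def stirling_diff_step(1))
  have inc: "incseq Y"
  proof (rule incseq_SucI)
    fix n show "Y n \<le> Y (Suc n)"
      using stirling_diff_step(2)[of "Suc n"] by (simp add: X_def Y_def)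
  qed
  have "Y 0 \<le> X n" for n
    using incseqD[OF inc, of 0 n] by (force simp: Y_def intro: order_trans)
  then obtain c where c: "X \<longlonglongrightarrow> c" "\<And>n. c \<le> X n"
    using decseq_convergent[OF dec] by metis
  have "Y \<longlonglongrightarrow> c - 0"
    unfolding Y_def by (intro tendsto_diff c) real_asymp
  hence Y: "Y n \<le> c" for n
    using incseq_le[OF inc] by simp
  show ?thesis
  proof
    show "stirling_diff \<longlonglongrightarrow> c"
      using c(1) unfolding X_def by (rule LIMSEQ_imp_Suc)
    fix n :: nat assume "n \<ge> 1"
    then obtain m where "n = Suc m" by (cases n) auto
    thus "c \<le> stirling_diff n" "stirling_diff n \<le> c + 1 / real n"
      using c(2)[of m] Y[of m] by (auto simp: X_def Y_def)
  qed
qed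

section \<open>Wallis' product and the constant in Stirling's formula\<close>

lemma wallis_product_eq:
  "(\<Prod>k=1..n. (4 * real k^2) / (4 * real k^2 - 1)) =
     (4^n * (fact n)^2 / fact (2 * n))^2 / (2 * real n + 1)"
proof (induction n)
  case (Suc n)
  define A where "A = 4^n * (fact n)^2 / (fact (2 * n) :: real)"
  have "4 * (real (Suc n))^2 - 1 = (2 * real n + 1) * (2 * real n + 3)"
    by (simp add: power2_eq_square algebra_simps)
  moreover have "4 ^ Suc n * (fact (Suc n))^2 / (fact (2 * Suc n) :: real) =
      A * (2 * (real n + 1) / (2 * real n + 1))"
    by (simp add: A_def divide_simps) (simp add: algebra_simps power2_eq_square)
  moreover have "2 * real (Suc n) + 1 = 2 * real n + 3"
    by simp
  moreover have "A\<^sup>2 / (2 * real n + 1) * (4 * (real n + 1)\<^sup>2 / ((2 * real n + 1) * (2 * real n + 3))) =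
      (A * (2 * (real n + 1) / (2 * real n + 1)))\<^sup>2 / (2 * real n + 3)"
    by (simp add: power2_eq_square field_simps)
  ultimately show ?case
    by (simp only: prod.cl_ivl_Suc Suc.IH A_def [symmetric]) (simp add: add_ac)
qed auto

text \<open>If \<open>c\<close> is the limit, then
  \<open>2 * stirling_diff n - stirling_diff (2 * n)\<close> also tends to \<open>c\<close>. The
  exponential of its double is a partial Wallis product times a factor tending to 4, so
  \<open>exp (2 * c) = 2 * pi\<close>.\<close>

lemma stirling_diff_limit: "stirling_diff \<longlonglongrightarrow> ln (2 * pi) / 2"
proof -
  obtain c where c: "stirling_diff \<longlonglongrightarrow> c"
    using stirling_diff_convergent by blast
  have "filterlim (\<lambda>n::nat. 2 * n) at_top at_top"
    by real_asymp
  hence "(\<lambda>n. stirling_diff (2 * n)) \<longlonglongrightarrow> c"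
    using c by (rule filterlim_compose[rotated])
  hence lim: "(\<lambda>n. exp (2 * (2 * stirling_diff n - stirling_diff (2 * n)))) \<longlonglongrightarrow> exp (2 * (2 * c - c))"
    by (intro tendsto_intros c)
  have ev: "\<forall>\<^sub>F n in sequentially. exp (2 * (2 * stirling_diff n - stirling_diff (2 * n))) =
     (\<Prod>k=1..n. (4 * real k^2) / (4 * real k^2 - 1)) * (2 * (2 * real n + 1) / real n)"
  proof (rule eventually_mono[OF eventually_gt_at_top[of 0]])
    fix n :: nat assume n: "n > 0"
    have "2 * stirling_diff n - stirling_diff (2 * n) =
        2 * ln (fact n) - ln (fact (2 * n)) + 2 * real n * ln 2 + ln 2 / 2 - ln (real n) / 2"
      using n by (simp add: stirling_diff_def ln_mult algebra_simps)
    hence "2 * (2 * stirling_diff n - stirling_diff (2 * n)) =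
       ln ((4^n * (fact n)^2 / fact (2 * n))^2 * 2 / real n)"
      using n ln_realpow[of 2 2] by (simp add: ln_mult ln_div ln_realpow)
    thus "exp (2 * (2 * stirling_diff n - stirling_diff (2 * n))) =
       (\<Prod>k=1..n. (4 * real k^2) / (4 * real k^2 - 1)) * (2 * (2 * real n + 1) / real n)"
      unfolding wallis_product_eq using n by (simp add: divide_simps)
  qed
  have "(\<lambda>n. (\<Prod>k=1..n. (4 * real k^2) / (4 * real k^2 - 1)) * (2 * (2 * real n + 1) / real n))
     \<longlonglongrightarrow> pi / 2 * 4"
    by (intro tendsto_mult wallis) real_asymp
  hence "(\<lambda>n. exp (2 * (2 * stirling_diff n - stirling_diff (2 * n)))) \<longlonglongrightarrow> pi / 2 * 4"
    by (subst tendsto_cong[OF ev])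
  with lim have "exp (2 * (2 * c - c)) = pi / 2 * 4"
    by (rule LIMSEQ_unique)
  hence "ln (exp (2 * c)) = ln (2 * pi)"
    by simp
  hence "c = ln (2 * pi) / 2"
    by simp
  with c show ?thesis by simp
qed

lemma stirling_bounds:
  assumes "n \<ge> 1"
  shows "(real n + 1/2) * ln (real n) - real n + ln (2 * pi) / 2 \<le> ln (fact n)"
    and "ln (fact n) \<le> (real n + 1/2) * ln (real n) - real n + ln (2 * pi) / 2 + 1 / real n"
proof -
  obtain c where c: "stirling_diff \<longlonglongrightarrow> c" "c \<le> stirling_diff n" "stirling_diff n \<le> c + 1 / real n"
    using stirling_diff_convergent assms by metis
  have "c = ln (2 * pi) / 2"
    using c(1) stirling_diff_limit by (rule LIMSEQ_unique)
  with c(2,3) show "(real n + 1/2) * ln (real n) - real n + ln (2 * pi) / 2 \<le> ln (fact n)"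
    and "ln (fact n) \<le> (real n + 1/2) * ln (real n) - real n + ln (2 * pi) / 2 + 1 / real n"
    by (simp_all add: stirling_diff_def)
qed

section \<open>The mode of a binomial distribution\<close>

definition bin_mass :: "nat \<Rightarrow> real \<Rightarrow> nat \<Rightarrow> real" where
  "bin_mass N p j = real (N choose j) * p ^ j * (1 - p) ^ (N - j)"

lemma bin_mass_pos: "0 < p \<Longrightarrow> p < 1 \<Longrightarrow> j \<le> N \<Longrightarrow> 0 < bin_mass N p j"
  by (simp add: bin_mass_def)

lemma sum_bin_mass: "(\<Sum>j\<le>N. bin_mass N p j) = 1"
  using binomial_ring[of p "1 - p" N] by (simp add: bin_mass_def)

text \<open>The ratio of neighbouring masses, cross-multiplied to avoid division; it locates the
  mode.\<close>

lemma bin_mass_Suc: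
  assumes "j < N"
  shows "real (Suc j) * (1 - p) * bin_mass N p (Suc j) = real (N - j) * p * bin_mass N p j"
proof -
  have "Suc j * (N choose Suc j) = (N - j) * (N choose j)"
    using assms by (metis binomial_absorption binomial_absorb_comp)
  hence "real (Suc j) * real (N choose Suc j) = real (N - j) * real (N choose j)"
    by (metis of_nat_mult)
  moreover have "N - j = Suc (N - Suc j)" using assms by simp
  ultimately show ?thesis
    unfolding bin_mass_def by (simp add: mult_ac del: of_nat_Suc)
qed

text \<open>Neither neighbour of a maximiser has larger mass, so the ratio identity on both sides
  confines it to distance 1 from the mean \<open>N * p\<close>.\<close>

lemma bin_mass_mode:
  assumes p: "0 < p" "p < 1"
  obtains j where "j \<le> N" "\<And>x. bin_mass N p x \<le> bin_mass N p j"
    "\<bar>real j - real N * p\<bar> \<le> 1"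
proof -
  define M where "M = Max (bin_mass N p ` {..N})"
  have "M \<in> bin_mass N p ` {..N}" unfolding M_def by (intro Max_in) auto
  then obtain j where j: "j \<le> N" "M = bin_mass N p j" by auto
  have le: "bin_mass N p x \<le> bin_mass N p j" for x
  proof (cases "x \<le> N")
    case True
    thus ?thesis unfolding j(2)[symmetric] M_def by (intro Max_ge) auto
  next
    case False
    hence "bin_mass N p x = 0" by (simp add: bin_mass_def binomial_eq_0)
    thus ?thesis using bin_mass_pos[OF p j(1)] by simp
  qed
  have "real j \<ge> real N * p - 1"
  proof (cases "j < N")
    case True
    have "real (N - j) * p * bin_mass N p j \<le> real (Suc j) * (1 - p) * bin_mass N p j"
      unfolding bin_mass_Suc[OF True, symmetric] using p le by (intro mult_left_mono) auto
    hence "real (N - j) * p \<le> real (Suc j) * (1 - p)"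
      using bin_mass_pos[OF p j(1)] by simp
    thus ?thesis using p j(1) by (simp add: of_nat_diff algebra_simps)
  next
    case False
    hence "real j \<ge> real N * 1" using j by simp
    moreover have "real N * p \<le> real N * 1" using p by (intro mult_left_mono) auto
    ultimately show ?thesis by linarith
  qed
  moreover have "real j \<le> real N * p + 1"
  proof (cases j)
    case 0
    thus ?thesis using p by simp
  next
    case (Suc i)
    have "real (Suc i) * (1 - p) * bin_mass N p j = real (N - i) * p * bin_mass N p i"
      using bin_mass_Suc[of i N p] Suc j by simp
    also have "\<dots> \<le> real (N - i) * p * bin_mass N p j"
      using p le by (intro mult_left_mono) auto
    finally have "real (Suc i) * (1 - p) \<le> real (N - i) * p"
      using bin_mass_pos[OF p j(1)] by simp
    thus ?thesis using p j(1) Suc by (simp add: of_nat_diff algebra_simps)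
  qed
  ultimately show ?thesis using that[OF j(1) le] by (simp add: abs_le_iff)
qed

text \<open>Stirling's bounds for the three factorials leave the Gaussian prefactor minus a relative
  entropy, which lies between 0 and a chi-squared term. The reciprocals are the Stirling errors of
  the factorials entering with the unfavourable sign.\<close>

lemma ln_bin_mass_bounds:
  assumes p: "0 < p" "p < 1" and j: "0 < j" "j < N"
  shows "ln (bin_mass N p j) \<le> ln (real N / (2 * pi * (real j * real (N - j)))) / 2 + 1 / real N"
    and "ln (real N / (2 * pi * (real j * real (N - j)))) / 2 - (real j - real N * p)^2 / (real N * p * (1 - p))
           - 1 / real j - 1 / real (N - j) \<le> ln (bin_mass N p j)"
proof -
  define x y z where "x = real j" "y = real (N - j)" "z = real N"
  have xyz: "x > 0" "y > 0" "z > 0" "z = x + y" "x \<noteq> 0" "y \<noteq> 0" "z \<noteq> 0"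
    using j by (auto simp: x_y_z_def)
  \<comment> \<open>This is \<open>N\<close> times the Kullback-Leibler divergence of the frequency
    \<open>j / N\<close> from \<open>p\<close>.\<close>
  define KL where "KL = x * ln (x / (z * p)) + y * ln (y / (z * (1 - p)))"
  have "real (N choose j) = fact N / (fact j * fact (N - j))"
    using j by (simp add: binomial_fact)
  hence lnb: "ln (bin_mass N p j) =
      ln (fact N) - ln (fact j) - ln (fact (N - j)) + x * ln p + y * ln (1 - p)"
    using p j by (simp add: bin_mass_def ln_mult ln_div ln_realpow x_y_z_def)
  have main: "(z + 1/2) * ln z - z + ln (2*pi)/2 - ((x + 1/2) * ln x - x + ln (2*pi)/2)
      - ((y + 1/2) * ln y - y + ln (2*pi)/2) + x * ln p + y * ln (1 - p)
      = ln (z / (2 * pi * (x * y))) / 2 - KL"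
    using xyz(1-3,5-7) p unfolding KL_def
    by (simp add: ln_div ln_mult xyz(4)) (simp add: field_simps)
  \<comment> \<open>Gibbs' inequality: \<open>ln u \<le> u - 1\<close> is applied to the inverted
    ratios. Below, the same inequality for the ratios themselves gives the upper bound.\<close>
  have "x * (1 - z * p / x) \<le> x * ln (x / (z * p))"
    using xyz p ln_le_minus_one[of "z * p / x"] by (intro mult_left_mono) (auto simp: ln_div)
  moreover have "y * (1 - z * (1 - p) / y) \<le> y * ln (y / (z * (1 - p)))"
    using xyz p ln_le_minus_one[of "z * (1 - p) / y"] by (intro mult_left_mono) (auto simp: ln_div)
  moreover have "x * (1 - z * p / x) + y * (1 - z * (1 - p) / y) = 0"
    using xyz(1-3) unfolding xyz(4) by (simp add: field_simps)
  ultimately have KL0: "0 \<le> KL" unfolding KL_def by linarith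
  have "x * ln (x / (z * p)) \<le> x * (x / (z * p) - 1)"
    using xyz p by (intro mult_left_mono ln_le_minus_one) auto
  moreover have "y * ln (y / (z * (1 - p))) \<le> y * (y / (z * (1 - p)) - 1)"
    using xyz p by (intro mult_left_mono ln_le_minus_one) auto
  moreover have "x * (x / (z * p) - 1) + y * (y / (z * (1 - p)) - 1) = (x - z * p)^2 / (z * p * (1 - p))"
  proof -
    have y: "y = z - x" using xyz by simp
    show ?thesis unfolding y using xyz(1-3) p
      by (simp add: divide_simps) (simp add: algebra_simps power2_eq_square)
  qed
  ultimately have KL1: "KL \<le> (x - z * p)^2 / (z * p * (1 - p))" unfolding KL_def by linarith
  have N1: "N \<ge> 1" "j \<ge> 1" "N - j \<ge> 1" using j by auto
  note st = stirling_bounds[OF N1(1)] stirling_bounds[OF N1(2)] stirling_bounds[OF N1(3)]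
  show "ln (bin_mass N p j) \<le> ln (real N / (2 * pi * (real j * real (N - j)))) / 2 + 1 / real N"
    using st lnb main KL0 unfolding x_y_z_def by linarith
  show "ln (real N / (2 * pi * (real j * real (N - j)))) / 2 - (real j - real N * p)^2 / (real N * p * (1 - p))
           - 1 / real j - 1 / real (N - j) \<le> ln (bin_mass N p j)"
    using st lnb main KL1 unfolding x_y_z_def by linarith
qed

text \<open>Each bound is written as the Gaussian peak height times an explicit factor tending to 1,
  so that only that factor needs an asymptotic expansion.\<close>

lemma bin_mass_mode_bounds:
  assumes p: "0 < p" "p < 1" and N: "2 \<le> real N * p" "2 \<le> real N * (1 - p)"
    and j: "\<bar>real j - real N * p\<bar> \<le> 1"
  shows "bin_mass N p j \<le> 1 / sqrt (2 * pi * real N * p * (1 - p)) *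
      (exp (1 / real N) / sqrt ((1 - 1 / p / real N) * (1 - 1 / (1 - p) / real N)))"
    and "1 / sqrt (2 * pi * real N * p * (1 - p)) *
      (exp (- ((1 / (p * (1 - p)) + 2 / p + 2 / (1 - p)) / real N)) /
       sqrt ((1 + 1 / p / real N) * (1 + 1 / (1 - p) / real N))) \<le> bin_mass N p j"
proof -
  have jb: "real N * p - 1 \<le> real j" "real j \<le> real N * p + 1" using j by auto
  have j0: "0 < j" using jb N by (cases j) auto
  have "real j < real N" using jb N by (simp add: algebra_simps)
  hence jN: "j < N" by simp
  define y where "y = real (N - j)"
  have yb: "real N * (1 - p) - 1 \<le> y" "y \<le> real N * (1 - p) + 1"
    using jb jN by (auto simp: y_def of_nat_diff algebra_simps)
  have pos: "0 < real j" "0 < y" "0 < real N" "0 < bin_mass N p j"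
    using j0 jN bin_mass_pos[OF p] by (auto simp: y_def)
  note lb = ln_bin_mass_bounds[OF p j0 jN, folded y_def]
  have root: "exp (ln (real N / (2 * pi * (real j * y))) / 2) = sqrt (real N / (2 * pi * (real j * y)))"
    using pos by (simp flip: ln_sqrt)
  \<comment> \<open>Used with \<open>s = -1\<close> for the upper and \<open>s = 1\<close> for the
    lower bound, since \<open>j\<close> and \<open>N - j\<close> differ from their means by at most
    1.\<close>
  have factor: "sqrt (real N / (2 * pi * ((real N * p + s) * (real N * (1 - p) + s)))) =
      1 / sqrt (2 * pi * real N * p * (1 - p)) / sqrt ((1 + s / p / real N) * (1 + s / (1 - p) / real N))" for s
  proof -
    have "real N * p + s = real N * p * (1 + s / p / real N)"
      "real N * (1 - p) + s = real N * (1 - p) * (1 + s / (1 - p) / real N)"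
      using p pos by (simp_all add: field_simps)
    hence "2 * pi * ((real N * p + s) * (real N * (1 - p) + s)) =
       real N * (2 * pi * real N * p * (1 - p) * ((1 + s / p / real N) * (1 + s / (1 - p) / real N)))"
      by (simp only: mult_ac)
    hence "real N / (2 * pi * ((real N * p + s) * (real N * (1 - p) + s))) =
       1 / (2 * pi * real N * p * (1 - p)) / ((1 + s / p / real N) * (1 + s / (1 - p) / real N))"
      using pos by simp
    thus ?thesis by (simp only: real_sqrt_divide real_sqrt_one)
  qed
  have "bin_mass N p j = exp (ln (bin_mass N p j))" using pos by simp
  also have "\<dots> \<le> exp (ln (real N / (2 * pi * (real j * y))) / 2 + 1 / real N)"
    using lb(1) by simp
  also have "\<dots> = sqrt (real N / (2 * pi * (real j * y))) * exp (1 / real N)"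
    by (simp add: exp_add root)
  also have "\<dots> \<le> sqrt (real N / (2 * pi * ((real N * p + (-1)) * (real N * (1 - p) + (-1))))) * exp (1 / real N)"
    using jb yb N pos
    by (intro mult_right_mono real_sqrt_le_mono divide_left_mono mult_left_mono mult_mono mult_pos_pos) auto
  finally show "bin_mass N p j \<le> 1 / sqrt (2 * pi * real N * p * (1 - p)) *
      (exp (1 / real N) / sqrt ((1 - 1 / p / real N) * (1 - 1 / (1 - p) / real N)))"
    unfolding factor by simp
  have "(real j - real N * p)^2 \<le> 1"
    using j by (simp add: abs_square_le_1)
  hence e1: "(real j - real N * p)^2 / (real N * p * (1 - p)) \<le> 1 / (real N * p * (1 - p))"
    using p pos by (auto intro!: divide_right_mono)
  \<comment> \<open>As both means are at least 2, subtracting 1 at most halves them. This turns the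
    Stirling errors into multiples of \<open>1 / N\<close>.\<close>
  have "real N * p / 2 \<le> real j" "real N * (1 - p) / 2 \<le> y"
    using jb yb N by linarith+
  hence "1 / real j \<le> 1 / (real N * p / 2)" "1 / y \<le> 1 / (real N * (1 - p) / 2)"
    using p pos by (intro divide_left_mono mult_pos_pos divide_pos_pos; simp)+
  moreover have "(1 / (p * (1 - p)) + 2 / p + 2 / (1 - p)) / real N =
      1 / (real N * p * (1 - p)) + 1 / (real N * p / 2) + 1 / (real N * (1 - p) / 2)"
    by (simp add: add_divide_distrib mult_ac)
  ultimately have e: "- ((1 / (p * (1 - p)) + 2 / p + 2 / (1 - p)) / real N)
       \<le> - ((real j - real N * p)^2 / (real N * p * (1 - p))) - 1 / real j - 1 / y"
    using e1 by linarith
  have "sqrt (real N / (2 * pi * ((real N * p + 1) * (real N * (1 - p) + 1))))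
           * exp (- ((1 / (p * (1 - p)) + 2 / p + 2 / (1 - p)) / real N))
      \<le> sqrt (real N / (2 * pi * (real j * y)))
           * exp (- ((real j - real N * p)^2 / (real N * p * (1 - p))) - 1 / real j - 1 / y)"
    using e jb yb N pos
    by (intro mult_mono real_sqrt_le_mono divide_left_mono mult_left_mono mult_pos_pos) auto
  also have "\<dots> = exp (ln (real N / (2 * pi * (real j * y))) / 2 - (real j - real N * p)^2 / (real N * p * (1 - p)) - 1 / real j - 1 / y)"
    unfolding root [symmetric] by (simp flip: exp_add)
  also have "\<dots> \<le> exp (ln (bin_mass N p j))" using lb(2) by simp
  also have "\<dots> = bin_mass N p j" using pos by simp
  finally show "1 / sqrt (2 * pi * real N * p * (1 - p)) *
      (exp (- ((1 / (p * (1 - p)) + 2 / p + 2 / (1 - p)) / real N)) /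
       sqrt ((1 + 1 / p / real N) * (1 + 1 / (1 - p) / real N))) \<le> bin_mass N p j"
    unfolding factor by simp
qed

text \<open>The relative correction at the mode, with free positive constants in place of the
  expressions in \<open>p\<close>, so that the expansion at infinity is automatic.\<close>

lemma mode_correction_upper:
  fixes a b c :: real
  assumes "a > 0" "b > 0" "c > 0"
  shows "(\<lambda>N::nat. exp (c / real N) / sqrt ((1 - a / real N) * (1 - b / real N)) - 1) \<in> O(\<lambda>N. 1 / real N)"
  using assms by real_asymp

lemma mode_correction_lower:
  fixes a b c :: real
  assumes "a > 0" "b > 0" "c > 0"
  shows "(\<lambda>N::nat. exp (- (c / real N)) / sqrt ((1 + a / real N) * (1 + b / real N)) - 1) \<in> O(\<lambda>N. 1 / real N)"
  using assms by real_asymp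

text \<open>The finitely many indices before the asymptotic bound sets in are absorbed by adding the
  sum of their ratios to the constant.\<close>

lemma bigo_nat_uniform:
  fixes f g :: "nat \<Rightarrow> real"
  assumes "f \<in> O(g)" and g: "\<And>n. n \<ge> 1 \<Longrightarrow> 0 < g n"
  obtains C where "C \<ge> 0" "\<And>n. n \<ge> 1 \<Longrightarrow> \<bar>f n\<bar> \<le> C * g n"
proof -
  obtain c where "c > 0" "\<forall>\<^sub>F n in sequentially. norm (f n) \<le> c * norm (g n)"
    using landau_o.bigE[OF assms(1)] by blast
  then obtain N where c: "c > 0" "\<And>n. n \<ge> N \<Longrightarrow> \<bar>f n\<bar> \<le> c * \<bar>g n\<bar>"
    by (auto simp: eventually_at_top_linorder)
  define S where "S = (\<Sum>n<N. \<bar>f n\<bar> / \<bar>g n\<bar>)"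
  have S: "S \<ge> 0" by (simp add: S_def sum_nonneg)
  show ?thesis
  proof (rule that[of "c + S"])
    show "c + S \<ge> 0" using c S by simp
    fix n :: nat assume n: "n \<ge> 1"
    show "\<bar>f n\<bar> \<le> (c + S) * g n"
    proof (cases "n < N")
      case True
      hence "\<bar>f n\<bar> / \<bar>g n\<bar> \<le> S" unfolding S_def by (intro member_le_sum) auto
      hence "\<bar>f n\<bar> \<le> S * g n" using g[OF n] by (simp add: field_simps)
      also have "\<dots> \<le> (c + S) * g n" using c g[OF n] by (intro mult_right_mono) auto
      finally show ?thesis .
    next
      case False
      hence "\<bar>f n\<bar> \<le> c * g n" using c(2)[of n] g[OF n] by simp
      also have "\<dots> \<le> (c + S) * g n" using S g[OF n] by (intro mult_right_mono) auto
      finally show ?thesis .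
    qed
  qed
qed

text \<open>The peak has order \<open>N powr (-1/2)\<close> and its relative error is
  \<open>O(1 / N)\<close>, which gives an absolute error of order \<open>N powr (-3/2)\<close>,
  summable over \<open>N\<close>.\<close>

lemma bin_mass_max_asymp:
  assumes p: "0 < p" "p < 1"
  obtains C where "C \<ge> 0"
    "\<And>N x. N \<ge> 1 \<Longrightarrow> bin_mass N p x \<le> 1 / sqrt (2 * pi * real N * p * (1 - p)) + C * real N powr (-3/2)"
    "\<And>N. N \<ge> 1 \<Longrightarrow> \<exists>x\<le>N. 1 / sqrt (2 * pi * real N * p * (1 - p)) - C * real N powr (-3/2) \<le> bin_mass N p x"
proof -
  define g where "g N = 1 / sqrt (2 * pi * real N * p * (1 - p))" for N
  define U where "U N = exp (1 / real N) / sqrt ((1 - 1 / p / real N) * (1 - 1 / (1 - p) / real N)) - 1" for N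
  define L where "L N = exp (- ((1 / (p * (1 - p)) + 2 / p + 2 / (1 - p)) / real N)) /
       sqrt ((1 + 1 / p / real N) * (1 + 1 / (1 - p) / real N)) - 1" for N
  have "\<exists>j. j \<le> N \<and> (\<forall>x. bin_mass N p x \<le> bin_mass N p j) \<and> \<bar>real j - real N * p\<bar> \<le> 1" for N
    using bin_mass_mode[OF p, of N] by metis
  then obtain m where m: "m N \<le> N" "bin_mass N p x \<le> bin_mass N p (m N)" "\<bar>real (m N) - real N * p\<bar> \<le> 1" for N x
    by metis
  have UL: "U \<in> O(\<lambda>N. 1 / real N)" "L \<in> O(\<lambda>N. 1 / real N)"
    unfolding U_def L_def using p
    by (intro mode_correction_upper mode_correction_lower add_pos_pos divide_pos_pos mult_pos_pos; simp)+
  have "(\<lambda>N. bin_mass N p (m N) - g N) \<in> O(\<lambda>N. g N * (\<bar>U N\<bar> + \<bar>L N\<bar>))"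
  proof (rule landau_o.big_mono)
    have "\<forall>\<^sub>F N in sequentially. 2 \<le> real N * p" "\<forall>\<^sub>F N in sequentially. 2 \<le> real N * (1 - p)"
      using p by real_asymp+
    thus "\<forall>\<^sub>F N in sequentially. norm (bin_mass N p (m N) - g N) \<le> norm (g N * (\<bar>U N\<bar> + \<bar>L N\<bar>))"
    proof eventually_elim
      case (elim N)
      note b = bin_mass_mode_bounds[OF p elim m(3)[of N], folded g_def]
      have g: "0 \<le> g N" using p by (simp add: g_def)
      have "bin_mass N p (m N) - g N \<le> g N * U N" "g N * L N \<le> bin_mass N p (m N) - g N"
        using b by (simp_all add: U_def L_def algebra_simps)
      moreover have "g N * U N \<le> g N * (\<bar>U N\<bar> + \<bar>L N\<bar>)" "g N * (- (\<bar>U N\<bar> + \<bar>L N\<bar>)) \<le> g N * L N"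
        using g by (auto intro!: mult_left_mono)
      ultimately show ?case using g by (simp add: abs_le_iff algebra_simps)
    qed
  qed
  also have "(\<lambda>N. g N * (\<bar>U N\<bar> + \<bar>L N\<bar>)) \<in> O(\<lambda>N. real N powr (-1/2) * (1 / real N))"
  proof (intro landau_o.big.mult sum_in_bigo)
    show "g \<in> O(\<lambda>N. real N powr (-1/2))" unfolding g_def using p by real_asymp
  qed (use UL in auto)
  also have "(\<lambda>N. real N powr (-1/2) * (1 / real N)) \<in> O(\<lambda>N. real N powr (-3/2))"
    by real_asymp
  finally obtain C where C: "C \<ge> 0"
    "\<And>N. N \<ge> 1 \<Longrightarrow> \<bar>bin_mass N p (m N) - g N\<bar> \<le> C * real N powr (-3/2)"
    by (rule bigo_nat_uniform) auto
  show ?thesis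
  proof (rule that[of C])
    show "C \<ge> 0" using C by simp
    fix N :: nat assume N: "N \<ge> 1"
    have *: "\<bar>bin_mass N p (m N) - g N\<bar> \<le> C * real N powr (-3/2)"
      using C(2)[OF N] by simp
    show "\<exists>x\<le>N. 1 / sqrt (2 * pi * real N * p * (1 - p)) - C * real N powr (-3/2) \<le> bin_mass N p x"
      unfolding g_def [symmetric] using * m(1)[of N] by (intro exI[of _ "m N"]) auto
    fix x
    show "bin_mass N p x \<le> 1 / sqrt (2 * pi * real N * p * (1 - p)) + C * real N powr (-3/2)"
      unfolding g_def [symmetric] using * m(2)[of N x] by linarith
  qed
qed

section \<open>Generating functions of the rows\<close>

text \<open>
  In an inverse \<open>a\<close>-shuffle every position receives an independent uniform digit below \<open>a\<close>.
  Given that position \<open>r\<close> (counted from 0) has digit \<open>d\<close>, the number of cards that end up in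
  front of it counts the earlier positions with digit \<open>\<le> d\<close> and the later ones with digit
  \<open>< d\<close>; \<open>digit_poly a n r d\<close> is the probability generating function of this number.
\<close>

definition digit_poly :: "nat \<Rightarrow> nat \<Rightarrow> nat \<Rightarrow> nat \<Rightarrow> real poly" where
  "digit_poly a n r d =
     [:1 - real (Suc d) / real a, real (Suc d) / real a:] ^ r * [:1 - real d / real a, real d / real a:] ^ (n - 1 - r)"

definition shuffle_poly :: "nat \<Rightarrow> nat \<Rightarrow> nat \<Rightarrow> real poly" where
  "shuffle_poly a n r = Polynomial.smult (1 / real a) (\<Sum>d<a. digit_poly a n r d)"

text \<open>Each of the two parts of an entry is a binomial sum. Two variables \<open>u\<close>,
  \<open>v\<close> are kept because composing with a further shuffle substitutes the linear
  polynomials of adjacent digits for them.\<close>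

lemma riffle_entry_generating_function:
  fixes u v :: real
  assumes r: "r < n"
  shows "(\<Sum>j<n. riffle_entry (Suc r) (Suc j) n * (u ^ j * v ^ (n - 1 - j))) =
     (((u + v) / 2) ^ r * v ^ (n - 1 - r) + u ^ r * ((u + v) / 2) ^ (n - 1 - r)) / 2"
proof -
  define s where "s = n - 1 - r"
  have n: "n = Suc (r + s)" using r by (simp add: s_def)
  have "(\<Sum>j<n. real (r choose j) * (u ^ j * v ^ (n - 1 - j))) = (\<Sum>j\<le>r. real (r choose j) * (u ^ j * v ^ (n - 1 - j)))"
    by (rule sum.mono_neutral_right) (auto simp: n)
  also have "\<dots> = (\<Sum>j\<le>r. real (r choose j) * u ^ j * v ^ (r - j) * v ^ s)"
    by (intro sum.cong refl) (simp add: n flip: power_add)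
  also have "\<dots> = (u + v) ^ r * v ^ s"
    by (simp add: binomial_ring sum_distrib_right)
  finally have 1: "(\<Sum>j<n. real (r choose j) * (u ^ j * v ^ (n - 1 - j))) = (u + v) ^ r * v ^ s" .
  have "(\<Sum>j<n. (if r \<le> j then real (s choose (j - r)) else 0) * (u ^ j * v ^ (n - 1 - j))) =
      (\<Sum>j\<in>{0+r..s+r}. real (s choose (j - r)) * (u ^ j * v ^ (n - 1 - j)))"
    by (rule sum.mono_neutral_cong_right) (auto simp: n)
  also have "\<dots> = (\<Sum>j\<le>s. real (s choose j) * (u ^ (j + r) * v ^ (n - 1 - (j + r))))"
    by (subst sum.shift_bounds_cl_nat_ivl) (simp add: atMost_atLeast0)
  also have "\<dots> = (\<Sum>j\<le>s. u ^ r * (real (s choose j) * u ^ j * v ^ (s - j)))"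
    by (intro sum.cong refl) (simp add: n power_add mult_ac)
  also have "\<dots> = u ^ r * (u + v) ^ s"
    by (simp add: binomial_ring sum_distrib_left)
  finally have 2: "(\<Sum>j<n. (if r \<le> j then real (s choose (j - r)) else 0) * (u ^ j * v ^ (n - 1 - j))) = u ^ r * (u + v) ^ s" .
  have "(\<Sum>j<n. riffle_entry (Suc r) (Suc j) n * (u ^ j * v ^ (n - 1 - j))) =
     1 / 2 ^ Suc r * (\<Sum>j<n. real (r choose j) * (u ^ j * v ^ (n - 1 - j))) +
     1 / 2 ^ Suc s * (\<Sum>j<n. (if r \<le> j then real (s choose (j - r)) else 0) * (u ^ j * v ^ (n - 1 - j)))"
    unfolding sum_distrib_left sum.distrib [symmetric]
    by (intro sum.cong refl) (simp add: riffle_entry_def n algebra_simps)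
  thus ?thesis
    unfolding 1 2 s_def [symmetric] by (simp add: power_divide field_simps)
qed

lemma sum_lessThan_double: "(\<Sum>d<2 * a. f d) = (\<Sum>d<a. f (2 * d) + f (Suc (2 * d)))"
  for f :: "nat \<Rightarrow> 'a :: comm_monoid_add"
  by (induction a) (simp_all add: add_ac)

text \<open>A riffle shuffle composed with an \<open>a\<close>-shuffle is a
  \<open>2 * a\<close>-shuffle: every digit \<open>d\<close> splits into \<open>2 * d\<close> and
  \<open>2 * d + 1\<close>. The identity is checked by evaluating at every real point.\<close>

lemma shuffle_poly_double:
  assumes "a > 0" "r < n"
  shows "(\<Sum>j<n. Polynomial.smult (riffle_entry (Suc r) (Suc j) n) (shuffle_poly a n j)) = shuffle_poly (2 * a) n r"
proof -
  \<comment> \<open>The value at \<open>x\<close> of the Bernoulli generating function with success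
    probability \<open>d / a\<close>. It is affine in \<open>d\<close>, so odd digits at level
    \<open>2 * a\<close> give midpoints.\<close>
  define w where "w a d x = 1 + real d / real a * (x - 1)" for a d and x :: real
  have poly_digit: "poly (digit_poly b n j d) x = w b (Suc d) x ^ j * w b d x ^ (n - 1 - j)" for b j d x
  proof -
    have "poly [:1 - q, q:] x = 1 + q * (x - 1)" for q
      by (simp add: algebra_simps)
    thus ?thesis by (simp only: digit_poly_def poly_mult poly_power w_def)
  qed
  have w: "w (2 * a) (2 * d) x = w a d x" "w (2 * a) (Suc (2 * d)) x = (w a (Suc d) x + w a d x) / 2"
      "w (2 * a) (Suc (Suc (2 * d))) x = w a (Suc d) x" for d x
    using assms by (simp_all add: w_def field_simps)
  have "poly (\<Sum>j<n. Polynomial.smult (riffle_entry (Suc r) (Suc j) n) (shuffle_poly a n j)) x = poly (shuffle_poly (2 * a) n r) x" for x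
  proof -
    have "poly (\<Sum>j<n. Polynomial.smult (riffle_entry (Suc r) (Suc j) n) (shuffle_poly a n j)) x =
        (\<Sum>j<n. \<Sum>d<a. 1 / real a * (riffle_entry (Suc r) (Suc j) n * (w a (Suc d) x ^ j * w a d x ^ (n - 1 - j))))"
      by (simp add: poly_sum shuffle_poly_def poly_digit sum_distrib_left sum_divide_distrib mult_ac)
    also have "\<dots> = (\<Sum>d<a. \<Sum>j<n. 1 / real a * (riffle_entry (Suc r) (Suc j) n * (w a (Suc d) x ^ j * w a d x ^ (n - 1 - j))))"
      by (rule sum.swap)
    also have "\<dots> = (\<Sum>d<a. 1 / real a *
        ((((w a (Suc d) x + w a d x) / 2) ^ r * w a d x ^ (n - 1 - r) +
          w a (Suc d) x ^ r * ((w a (Suc d) x + w a d x) / 2) ^ (n - 1 - r)) / 2))"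
      by (simp only: riffle_entry_generating_function[OF assms(2)] flip: sum_distrib_left)
    \<comment> \<open>The first summand for \<open>d\<close> is the contribution of digit
      \<open>2 * d\<close>, the second that of \<open>2 * d + 1\<close>.\<close>
    also have "\<dots> = 1 / real (2 * a) * (\<Sum>d<2 * a. poly (digit_poly (2 * a) n r d) x)"
      unfolding sum_lessThan_double poly_digit w sum_distrib_left
      by (intro sum.cong refl) simp
    also have "\<dots> = poly (shuffle_poly (2 * a) n r) x"
      by (simp only: shuffle_poly_def poly_sum poly_smult)
    finally show ?thesis .
  qed
  thus ?thesis by (intro poly_eq_poly_eq_iff[THEN iffD1] ext)
qed

section \<open>Powers of the riffle matrix\<close>

lemma riffle_mat_carrier: "riffle_mat n \<in> carrier_mat n n"
  by (simp add: riffle_mat_def)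

text \<open>The recursion for matrix powers adds the factor on the right; the doubling identity
  needs the single riffle on the left.\<close>

lemma pow_mat_Suc_left:
  fixes A :: "'a :: semiring_1 mat"
  assumes "A \<in> carrier_mat n n"
  shows "A ^\<^sub>m Suc k = A * A ^\<^sub>m k"
proof (induction k)
  case (Suc k)
  have "A ^\<^sub>m Suc (Suc k) = A * A ^\<^sub>m k * A" using Suc by simp
  also have "\<dots> = A * (A ^\<^sub>m k * A)"
    using assms by (intro assoc_mult_mat) auto
  finally show ?case by simp
qed (use assms in auto)

lemma riffle_mat_power_entry:
  assumes "r < n" "c < n"
  shows "(riffle_mat n ^\<^sub>m k) $$ (r, c) = coeff (shuffle_poly (2 ^ k) n r) c"
  using assms(1)
proof (induction k arbitrary: r)
  case 0
  \<comment> \<open>With one digit nothing moves, which matches the identity matrix.\<close>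
  have "shuffle_poly 1 n r = monom 1 r"
    by (simp add: shuffle_poly_def digit_poly_def monom_altdef pCons_one)
  thus ?case using 0 assms by (simp add: riffle_mat_def)
next
  case (Suc k)
  note car = riffle_mat_carrier[of n] pow_carrier_mat[OF riffle_mat_carrier, of n k]
  have "(riffle_mat n ^\<^sub>m Suc k) $$ (r, c) = (riffle_mat n * riffle_mat n ^\<^sub>m k) $$ (r, c)"
    by (simp only: pow_mat_Suc_left[OF car(1)])
  also have "\<dots> = (\<Sum>j<n. riffle_mat n $$ (r, j) * (riffle_mat n ^\<^sub>m k) $$ (j, c))"
    using Suc.prems assms car by (simp add: scalar_prod_def atLeast0LessThan)
  also have "\<dots> = (\<Sum>j<n. riffle_entry (Suc r) (Suc j) n * coeff (shuffle_poly (2 ^ k) n j) c)"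
    using Suc.prems by (intro sum.cong refl) (simp add: Suc.IH, simp add: riffle_mat_def)
  also have "\<dots> = coeff (shuffle_poly (2 ^ Suc k) n r) c"
    using shuffle_poly_double[of "2 ^ k" r n, symmetric] Suc.prems by (simp add: coeff_sum)
  finally show ?case .
qed

section \<open>Estimates for the entries\<close>

lemma coeff_bernoulli_power: "coeff ([:1 - p, p:] ^ N) x = bin_mass N p x"
proof (cases "x \<le> N")
  case True
  thus ?thesis by (simp add: coeff_linear_poly_power bin_mass_def)
next
  case False
  have "degree ([:1 - p, p:] ^ N) \<le> degree [:1 - p, p:] * N" by (rule degree_power_le)
  also have "\<dots> \<le> 1 * N" by (intro mult_right_mono) auto
  finally have "coeff ([:1 - p, p:] ^ N) x = 0" using False by (intro coeff_eq_0) simp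
  thus ?thesis using False by (simp add: bin_mass_def binomial_eq_0)
qed

lemma bin_mass_nonneg: "0 \<le> p \<Longrightarrow> p \<le> 1 \<Longrightarrow> 0 \<le> bin_mass N p x"
  by (simp add: bin_mass_def)

lemma bin_mass_le_1:
  assumes "0 \<le> p" "p \<le> 1"
  shows "bin_mass N p x \<le> 1"
proof (cases "x \<le> N")
  case True
  hence "bin_mass N p x \<le> (\<Sum>j\<le>N. bin_mass N p j)"
    using assms by (intro member_le_sum) (auto simp: bin_mass_nonneg)
  thus ?thesis by (simp add: sum_bin_mass)
qed (simp add: bin_mass_def binomial_eq_0)

lemma coeff_mult_nonneg:
  fixes f g :: "real poly"
  assumes "\<And>i. 0 \<le> coeff f i" "\<And>i. 0 \<le> coeff g i"
  shows "0 \<le> coeff (f * g) i"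
  using assms by (simp add: coeff_mult sum_nonneg)

lemma sum_coeff_le_poly:
  fixes f :: "real poly"
  assumes "finite A" and f: "\<And>i. 0 \<le> coeff f i" and "0 \<le> z"
  shows "(\<Sum>i\<in>A. coeff f i * z ^ i) \<le> poly f z"
proof -
  have "(\<Sum>i\<in>A. coeff f i * z ^ i) = (\<Sum>i\<in>A \<inter> {..degree f}. coeff f i * z ^ i)"
    using assms(1) by (intro sum.mono_neutral_right) (auto simp: coeff_eq_0)
  also have "\<dots> \<le> (\<Sum>i\<le>degree f. coeff f i * z ^ i)"
    using f assms(3) by (intro sum_mono2) auto
  finally show ?thesis by (simp add: poly_altdef)
qed

text \<open>Convolution with a probability distribution cannot raise the largest point mass.\<close>

lemma coeff_mult_le_max:
  fixes f g :: "real poly"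
  assumes f: "\<And>i. coeff f i \<le> M" and g: "\<And>i. 0 \<le> coeff g i" "poly g 1 = 1" and M: "0 \<le> M"
  shows "coeff (f * g) x \<le> M"
proof -
  have "coeff (f * g) x \<le> (\<Sum>i\<le>x. M * coeff g (x - i))"
    unfolding coeff_mult using f g by (intro sum_mono mult_right_mono) auto
  also have "\<dots> = M * (\<Sum>i\<le>x. coeff g i * 1 ^ i)"
    using sum.nat_diff_reindex[of "coeff g" "Suc x"]
    by (simp add: lessThan_Suc_atMost flip: sum_distrib_left)
  also have "\<dots> \<le> M * poly g 1"
    using g M by (intro mult_left_mono sum_coeff_le_poly) auto
  finally show ?thesis using g by simp
qed

lemma digit_poly_coeff_nonneg:
  assumes "d < a"
  shows "0 \<le> coeff (digit_poly a n r d) c"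
  unfolding digit_poly_def using assms
  by (intro coeff_mult_nonneg) (auto simp: coeff_bernoulli_power intro!: bin_mass_nonneg simp del: of_nat_Suc)

text \<open>A Chernoff bound: the number subtracted from \<open>c\<close> is the mean of the
  component, and the distance required is half the spacing of neighbouring means. The exponential
  bound is weakened to \<open>O(1 / n)\<close>, which still sums to a constant over \<open>n\<close>
  rows.\<close>

lemma digit_poly_tail:
  assumes d: "d < a" and r: "r < n" and c: "c < n"
    and far: "real (n - 1) / (2 * real a) \<le> \<bar>real c - (real r + real (n - 1) * real d) / real a\<bar>"
  shows "coeff (digit_poly a n r d) c \<le> 32 * real a ^ 2 / real n"
proof -
  define \<mu> where "\<mu> = (real r + real (n - 1) * real d) / real a"
  \<comment> \<open>The sign selects the upper or lower tail. With size \<open>1 / (8 * a)\<close>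
    the linear gain \<open>(n - 1) / (16 * a^2)\<close> is twice the quadratic loss
    \<open>2 * (n - 1) * t^2\<close>.\<close>
  define t where "t = (if real c \<ge> \<mu> then 1 else -1) / (8 * real a)"
  define A where "A = real a"
  have A: "A \<ge> 1" using d by (simp add: A_def)
  have t: "\<bar>t\<bar> \<le> 1/2" "t^2 = 1 / (64 * A^2)" 
    using A by (auto simp: t_def A_def[symmetric] abs_if power2_eq_square field_simps)
  have tc: "t * (\<mu> - real c) \<le> - real (n - 1) / (16 * A^2)"
  proof -
    have "t * (\<mu> - real c) = - (\<bar>real c - \<mu>\<bar> / (8 * A))"
      by (simp add: t_def A_def abs_if algebra_simps diff_divide_distrib)
    moreover have "real (n - 1) / (2 * A) / (8 * A) \<le> \<bar>real c - \<mu>\<bar> / (8 * A)"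
      using far A by (intro divide_right_mono) (auto simp: \<mu>_def A_def)
    ultimately show ?thesis by (simp add: power2_eq_square)
  qed
  have lin: "poly [:1 - q, q:] (1 + t) = 1 + q * t" for q
    by (simp add: algebra_simps)
  have lin_bounds: "0 \<le> 1 + q * t" if "0 \<le> q" "q \<le> 1" for q
  proof -
    have "\<bar>q * t\<bar> \<le> 1 * (1/2)" unfolding abs_mult using that t by (intro mult_mono) auto
    thus ?thesis by linarith
  qed
  \<comment> \<open>Markov's inequality: one term of the generating function is at most its
    value.\<close>
  have "coeff (digit_poly a n r d) c * (1 + t) ^ c \<le> poly (digit_poly a n r d) (1 + t)"
    using sum_coeff_le_poly[of "{c}" "digit_poly a n r d" "1 + t"] digit_poly_coeff_nonneg[OF d] t
    by (simp add: abs_le_iff)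
  also have "\<dots> = (1 + real (Suc d) / real a * t) ^ r * (1 + real d / real a * t) ^ (n - 1 - r)"
    by (simp only: digit_poly_def poly_mult poly_power lin)
  also have "\<dots> \<le> exp (real (Suc d) / real a * t) ^ r * exp (real d / real a * t) ^ (n - 1 - r)"
    using d by (intro mult_mono power_mono exp_ge_add_one_self lin_bounds zero_le_power) (auto simp del: of_nat_Suc)
  also have "\<dots> = exp (real r * (real (Suc d) / real a * t) + real (n - 1 - r) * (real d / real a * t))"
    by (simp only: exp_of_nat_mult exp_add)
  also have "real r * (real (Suc d) / real a * t) + real (n - 1 - r) * (real d / real a * t) = t * \<mu>"
  proof -
    have "real (n - 1 - r) = real (n - 1) - real r" using r by simp
    thus ?thesis using d by (simp only: \<mu>_def) (simp add: field_simps)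
  qed
  finally have 1: "coeff (digit_poly a n r d) c * (1 + t) ^ c \<le> exp (t * \<mu>)" .
  \<comment> \<open>Uses \<open>ln (1 + t) \<ge> t - 2 * t^2\<close> for
    \<open>\<bar>t\<bar> \<le> 1/2\<close>.\<close>
  have "exp (real c * (t - 2 * t^2)) \<le> exp (real c * ln (1 + t))"
    using abs_ln_one_plus_x_minus_x_bound[OF t(1)] by (auto intro!: mult_left_mono simp: abs_le_iff)
  also have "\<dots> = (1 + t) ^ c"
    using t(1) by (simp add: exp_of_nat_mult)
  finally have "coeff (digit_poly a n r d) c * exp (real c * (t - 2 * t^2)) \<le> exp (t * \<mu>)"
    using 1 digit_poly_coeff_nonneg[OF d] by (meson mult_left_mono order_trans)
  hence "coeff (digit_poly a n r d) c \<le> exp (t * \<mu> - real c * (t - 2 * t^2))"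
    by (simp add: exp_diff pos_le_divide_eq)
  also have "t * \<mu> - real c * (t - 2 * t^2) = t * (\<mu> - real c) + 2 * real c * t^2"
    by (simp add: algebra_simps)
  also have "\<dots> \<le> - real (n - 1) / (16 * A^2) + 2 * real (n - 1) * t^2"
    using c by (intro add_mono tc mult_right_mono) auto
  also have "\<dots> = - (real (n - 1) / (32 * A^2))"
    unfolding t(2) using A by (simp add: field_simps)
  finally have "coeff (digit_poly a n r d) c \<le> exp (- (real (n - 1) / (32 * A^2)))"
    by simp
  also have "\<dots> = 1 / exp (real (n - 1) / (32 * A^2))"
    by (simp add: exp_minus field_simps)
  also have "\<dots> \<le> 1 / (1 + real (n - 1) / (32 * A^2))"
    using A by (intro divide_left_mono exp_ge_add_one_self mult_pos_pos add_pos_nonneg) auto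
  also have "\<dots> = 32 * A^2 / (32 * A^2 + real (n - 1))"
    using A by (simp add: field_simps)
  also have "\<dots> \<le> 32 * A^2 / real n"
  proof -
    have "A^2 \<ge> 1" using A by simp
    hence "real n \<le> 32 * A^2 + real (n - 1)" using c by (simp add: of_nat_diff)
    thus ?thesis using c A by (intro divide_left_mono mult_pos_pos add_pos_nonneg) auto
  qed
  finally show ?thesis by (simp add: A_def)
qed

text \<open>Both \<open>1 / sqrt 0\<close> and \<open>0 powr (-3/2)\<close> evaluate to 0, so the
  value 1 at \<open>m = 0\<close> carries the trivial bound on a probability.\<close>

definition riffle_error :: "nat \<Rightarrow> real" where
  "riffle_error m = (if m = 0 then 1 else real m powr (-3/2))"

text \<open>Among \<open>p = d / a\<close> with \<open>0 < d < a\<close>, the variance factor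
  \<open>p * (1 - p)\<close> is least at the two ends, where it is \<open>(a - 1) / a^2\<close>.
  Summing the constants of the finitely many \<open>d\<close> makes the error uniform.\<close>

lemma bin_mass_uniform_bound:
  assumes a: "2 \<le> a"
  obtains C where "C \<ge> 1"
    "\<And>m N d x. m \<le> N \<Longrightarrow> 1 \<le> d \<Longrightarrow> d < a \<Longrightarrow>
       bin_mass N (real d / real a) x \<le> real a / sqrt (2 * pi * (real a - 1) * real m) + C * riffle_error m"
proof -
  have "\<exists>C\<ge>0. \<forall>N x. N \<ge> 1 \<longrightarrow>
      bin_mass N (real d / real a) x \<le> 1 / sqrt (2 * pi * real N * (real d / real a) * (1 - real d / real a)) + C * real N powr (-3/2)"
    if "1 \<le> d" "d < a" for d
  proof -
    have "0 < real d / real a" "real d / real a < 1" using that by auto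
    from bin_mass_max_asymp[OF this] show ?thesis by metis
  qed
  then obtain K where K: "\<And>d. 1 \<le> d \<Longrightarrow> d < a \<Longrightarrow> K d \<ge> 0"
    "\<And>d N x. 1 \<le> d \<Longrightarrow> d < a \<Longrightarrow> N \<ge> 1 \<Longrightarrow>
      bin_mass N (real d / real a) x \<le> 1 / sqrt (2 * pi * real N * (real d / real a) * (1 - real d / real a)) + K d * real N powr (-3/2)"
    by metis
  define C where "C = 1 + (\<Sum>d\<in>{1..<a}. K d)"
  have C1: "C \<ge> 1" unfolding C_def using K(1) by (auto intro!: sum_nonneg)
  have CK: "K d \<le> C" if "1 \<le> d" "d < a" for d
  proof -
    have "K d \<le> (\<Sum>d\<in>{1..<a}. K d)" using that K(1) by (intro member_le_sum) auto
    thus ?thesis by (simp add: C_def)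
  qed
  show ?thesis
  proof (rule that[OF C1])
    fix m N d x :: nat assume *: "m \<le> N" "1 \<le> d" "d < a"
    show "bin_mass N (real d / real a) x \<le> real a / sqrt (2 * pi * (real a - 1) * real m) + C * riffle_error m"
    proof (cases "m = 0")
      case True
      thus ?thesis using bin_mass_le_1[of "real d / real a" N x] C1 * by (simp add: riffle_error_def)
    next
      case False
      have var: "(real a - 1) / real a ^ 2 \<le> (real d / real a) * (1 - real d / real a)"
      proof -
        \<comment> \<open>Expanded, this is \<open>d * (a - d) \<ge> a - 1\<close>.\<close>
        have "0 \<le> (real d - 1) * (real a - real d - 1)" using * by (intro mult_nonneg_nonneg) auto
        hence "real a - 1 \<le> real d * (real a - real d)" by (simp add: algebra_simps)
        hence "(real a - 1) / real a ^ 2 \<le> real d * (real a - real d) / real a ^ 2"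
          by (intro divide_right_mono) auto
        also have "\<dots> = (real d / real a) * (1 - real d / real a)"
          using * by (simp add: field_simps power2_eq_square)
        finally show ?thesis .
      qed
      have "bin_mass N (real d / real a) x \<le>
         1 / sqrt (2 * pi * real N * ((real d / real a) * (1 - real d / real a))) + K d * real N powr (-3/2)"
        using K(2)[of d N x] * False by (simp add: mult.assoc)
      also have "\<dots> \<le> 1 / sqrt (2 * pi * real m * ((real a - 1) / real a ^ 2)) + C * real m powr (-3/2)"
        using * False a CK[of d] K(1)[of d] var
        by (intro add_mono divide_left_mono real_sqrt_le_mono mult_mono mult_pos_pos powr_mono2' divide_pos_pos) auto
      also have "2 * pi * real m * ((real a - 1) / real a ^ 2) = (2 * pi * (real a - 1) * real m) / (real a)^2"
        by simp
      also have "sqrt \<dots> = sqrt (2 * pi * (real a - 1) * real m) / real a"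
        by (simp add: real_sqrt_divide)
      finally show ?thesis using False by (simp add: riffle_error_def)
    qed
  qed
qed

text \<open>At least one factor has success probability strictly between 0 and 1: the first if
  \<open>d = 0\<close>, the second otherwise. Its exponent is at least the minimum, and convolving
  with the other factor does not raise the maximum.\<close>

lemma digit_poly_max_bound:
  assumes a: "2 \<le> a"
  obtains C where "C \<ge> 1"
    "\<And>n r d c. d < a \<Longrightarrow> coeff (digit_poly a n r d) c \<le>
        real a / sqrt (2 * pi * (real a - 1) * real (min r (n - 1 - r))) + C * riffle_error (min r (n - 1 - r))"
proof -
  obtain C where C: "C \<ge> 1"
    "\<And>m N d x. m \<le> N \<Longrightarrow> 1 \<le> d \<Longrightarrow> d < a \<Longrightarrow>
       bin_mass N (real d / real a) x \<le> real a / sqrt (2 * pi * (real a - 1) * real m) + C * riffle_error m"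
    using bin_mass_uniform_bound[OF a] by blast
  show ?thesis
  proof (rule that[OF C(1)])
    fix n r d c :: nat assume d: "d < a"
    define m where "m = min r (n - 1 - r)"
    define B where "B = real a / sqrt (2 * pi * (real a - 1) * real m) + C * riffle_error m"
    have B: "B \<ge> 0" unfolding B_def riffle_error_def using C(1) a by auto
    have one: "poly ([:1 - q, q:] ^ N) 1 = 1" for q :: real and N
      by (simp add: poly_power)
    have nonneg: "0 \<le> coeff ([:1 - real e / real a, real e / real a:] ^ N) i" if "e \<le> a" for e N i
      unfolding coeff_bernoulli_power using that a by (intro bin_mass_nonneg) auto
    have le: "coeff ([:1 - real e / real a, real e / real a:] ^ N) i \<le> B" if "1 \<le> e" "e < a" "m \<le> N" for e N i
      unfolding coeff_bernoulli_power B_def using that by (intro C(2)) auto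
    show "coeff (digit_poly a n r d) c \<le>
        real a / sqrt (2 * pi * (real a - 1) * real (min r (n - 1 - r))) + C * riffle_error (min r (n - 1 - r))"
      unfolding m_def [symmetric] B_def [symmetric] digit_poly_def
    proof (cases "d = 0")
      case True
      show "coeff ([:1 - real (Suc d) / real a, real (Suc d) / real a:] ^ r * [:1 - real d / real a, real d / real a:] ^ (n - 1 - r)) c \<le> B"
        using True a d by (intro coeff_mult_le_max le nonneg one B) (auto simp: m_def)
    next
      case False
      show "coeff ([:1 - real (Suc d) / real a, real (Suc d) / real a:] ^ r * [:1 - real d / real a, real d / real a:] ^ (n - 1 - r)) c \<le> B"
        using False a d by (subst mult.commute, intro coeff_mult_le_max le nonneg one B) (auto simp: m_def)
    qed
  qed
qed

section \<open>Two-sided bounds for the row maxima\<close>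

lemma shuffle_poly_coeff: "coeff (shuffle_poly a n r) c = (\<Sum>d<a. coeff (digit_poly a n r d) c) / real a"
  by (simp add: shuffle_poly_def coeff_sum)

text \<open>The windows of half-width \<open>(n - 1) / (2 * a)\<close> around the component means
  are disjoint, so at most one component is bounded by its peak and the rest by the tail estimate.
  The mixture weight \<open>1 / a\<close> cancels the factor \<open>a\<close> of the peak.\<close>

lemma shuffle_poly_upper:
  assumes a: "2 \<le> a"
  obtains C where "C \<ge> 0"
    "\<And>n r c. 2 \<le> n \<Longrightarrow> r < n \<Longrightarrow> c < n \<Longrightarrow> coeff (shuffle_poly a n r) c \<le>
        1 / sqrt (2 * pi * (real a - 1) * real (min r (n - 1 - r))) + C * riffle_error (min r (n - 1 - r))
        + 32 * real a ^ 2 / real n"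
proof -
  obtain C where C: "C \<ge> 1"
    "\<And>n r d c. d < a \<Longrightarrow> coeff (digit_poly a n r d) c \<le>
        real a / sqrt (2 * pi * (real a - 1) * real (min r (n - 1 - r))) + C * riffle_error (min r (n - 1 - r))"
    using digit_poly_max_bound[OF a] by blast
  have C0: "C \<ge> 0" using C by simp
  show ?thesis
  proof (rule that[OF C0])
    fix n r c :: nat assume n: "2 \<le> n" "r < n" "c < n"
    define m where "m = min r (n - 1 - r)"
    define g where "g = 1 / sqrt (2 * pi * (real a - 1) * real m)"
    define B where "B = real a * g + C * riffle_error m"
    define K where "K = 32 * real a ^ 2 / real n"
    define f where "f d = coeff (digit_poly a n r d) c" for d
    define near where "near d \<longleftrightarrow> \<bar>real c - (real r + real (n - 1) * real d) / real a\<bar> < real (n - 1) / (2 * real a)" for d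
    have e0: "riffle_error m \<ge> 0" by (simp add: riffle_error_def)
    have B0: "B \<ge> 0" unfolding B_def g_def using C0 e0 a by auto
    have K0: "K \<ge> 0" by (simp add: K_def)
    have fB: "f d \<le> B" if "d < a" for d
      using C(2)[OF that, of n r c] by (simp add: f_def B_def g_def m_def)
    have fK: "f d \<le> K" if "d < a" "\<not> near d" for d
      unfolding f_def K_def using that n by (intro digit_poly_tail) (auto simp: near_def not_less)
    have uniq: "d = d'" if "near d" "near d'" for d d'
    proof (rule ccontr)
      assume "d \<noteq> d'"
      hence "1 \<le> \<bar>real d - real d'\<bar>" by (cases d d' rule: linorder_cases) auto
      hence "real (n - 1) / real a * 1 \<le> real (n - 1) / real a * \<bar>real d - real d'\<bar>"
        by (intro mult_left_mono) auto
      also have "\<dots> = \<bar>(real r + real (n - 1) * real d) / real a - (real r + real (n - 1) * real d') / real a\<bar>"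
      proof -
        have "(real r + real (n - 1) * real d) / real a - (real r + real (n - 1) * real d') / real a =
            real (n - 1) / real a * (real d - real d')"
          using a by (simp add: field_simps)
        thus ?thesis by (simp only: abs_mult) simp
      qed
      also have "\<dots> < real (n - 1) / (2 * real a) + real (n - 1) / (2 * real a)"
        using that unfolding near_def by linarith
      finally show False using a by (simp add: field_simps)
    qed
    have "(\<Sum>d<a. f d) \<le> B + real a * K"
    proof (cases "\<exists>d<a. near d")
      case True
      then obtain d where d: "d < a" "near d" by blast
      have "(\<Sum>d<a. f d) = f d + (\<Sum>d\<in>{..<a} - {d}. f d)"
        using d by (intro sum.remove) auto
      also have "\<dots> \<le> B + (\<Sum>d\<in>{..<a} - {d}. K)"
        using d uniq by (intro add_mono fB sum_mono fK) auto
      also have "\<dots> \<le> B + (\<Sum>d<a. K)"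
        using K0 by (intro add_left_mono sum_mono2) auto
      finally show ?thesis by simp
    next
      case False
      hence "(\<Sum>d<a. f d) \<le> (\<Sum>d<a. K)" by (intro sum_mono fK) auto
      thus ?thesis using B0 by simp
    qed
    hence "(\<Sum>d<a. f d) / real a \<le> (B + real a * K) / real a"
      by (intro divide_right_mono) auto
    also have "\<dots> = g + C / real a * riffle_error m + K"
      using a by (simp add: B_def field_simps)
    also have "\<dots> \<le> g + C * riffle_error m + K"
      using a C0 e0 divide_left_mono[of 1 "real a" C] by (intro add_mono mult_right_mono) auto
    finally show "coeff (shuffle_poly a n r) c \<le>
        1 / sqrt (2 * pi * (real a - 1) * real (min r (n - 1 - r))) + C * riffle_error (min r (n - 1 - r))
        + 32 * real a ^ 2 / real n"
      by (simp only: shuffle_poly_coeff f_def g_def m_def K_def)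
  qed
qed

text \<open>Digit 0 contributes the law of \<open>Bin(r, 1/a)\<close>, digit \<open>a - 1\<close>
  that of \<open>r + Bin(n-1-r, (a-1)/a)\<close>. Keeping the one with the smaller number of trials
  already attains the main term.\<close>

lemma shuffle_poly_lower:
  assumes a: "2 \<le> a"
  obtains C where "C \<ge> 0"
    "\<And>n r. r < n \<Longrightarrow> \<exists>c<n. 1 / sqrt (2 * pi * (real a - 1) * real (min r (n - 1 - r)))
        - C * riffle_error (min r (n - 1 - r)) \<le> coeff (shuffle_poly a n r) c"
proof -
  have ge: "bin_mass N p x / real a \<le> coeff (shuffle_poly a n r) c"
    if "d < a" "coeff (digit_poly a n r d) c = bin_mass N p x" for N p x n r c d
    unfolding shuffle_poly_coeff that(2)[symmetric] using that digit_poly_coeff_nonneg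
    by (intro divide_right_mono member_le_sum) auto
  have scale: "1 / sqrt (2 * pi * (real a - 1) * real m) - C * riffle_error m \<le> b / real a"
    if "1 / sqrt (2 * pi * real m * p * (1 - p)) - C * real m powr (-3/2) \<le> b" "m \<ge> 1" "C \<ge> 0"
      "p * (1 - p) = (real a - 1) / real a ^ 2" for m C b p
  proof -
    have "2 * pi * real m * p * (1 - p) = (2 * pi * (real a - 1) * real m) / (real a)^2"
      using that(4) by (simp add: mult.assoc)
    hence "sqrt (2 * pi * real m * p * (1 - p)) = sqrt (2 * pi * (real a - 1) * real m) / real a"
      by (simp add: real_sqrt_divide)
    hence "real a / sqrt (2 * pi * (real a - 1) * real m) - C * riffle_error m \<le> b"
      using that by (simp add: riffle_error_def)
    hence "(real a / sqrt (2 * pi * (real a - 1) * real m) - C * riffle_error m) / real a \<le> b / real a"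
      by (intro divide_right_mono) auto
    moreover have "C * riffle_error m / real a \<le> C * riffle_error m / 1"
      using a that by (intro divide_left_mono) (auto simp: riffle_error_def)
    ultimately show ?thesis using a by (simp add: diff_divide_distrib)
  qed
  have "0 < 1 / real a" "1 / real a < 1" using a by auto
  then obtain C1 where C1: "C1 \<ge> 0"
    "\<And>N. N \<ge> 1 \<Longrightarrow> \<exists>x\<le>N. 1 / sqrt (2 * pi * real N * (1 / real a) * (1 - 1 / real a)) - C1 * real N powr (-3/2) \<le> bin_mass N (1 / real a) x"
    using bin_mass_max_asymp by metis
  have "0 < real (a - 1) / real a" "real (a - 1) / real a < 1" using a by auto
  then obtain C2 where C2: "C2 \<ge> 0"
    "\<And>N. N \<ge> 1 \<Longrightarrow> \<exists>x\<le>N. 1 / sqrt (2 * pi * real N * (real (a - 1) / real a) * (1 - real (a - 1) / real a)) - C2 * real N powr (-3/2) \<le> bin_mass N (real (a - 1) / real a) x"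
    using bin_mass_max_asymp by metis
  have pq: "1 / real a * (1 - 1 / real a) = (real a - 1) / real a ^ 2"
    "real (a - 1) / real a * (1 - real (a - 1) / real a) = (real a - 1) / real a ^ 2"
    using a by (simp_all add: of_nat_diff field_simps power2_eq_square)
  show ?thesis
  proof (rule that[of "C1 + C2"])
    show "C1 + C2 \<ge> 0" using C1 C2 by simp
    fix n r :: nat assume r: "r < n"
    define m where "m = min r (n - 1 - r)"
    define g where "g = 1 / sqrt (2 * pi * (real a - 1) * real m)"
    have e0: "riffle_error m \<ge> 0" by (simp add: riffle_error_def)
    have weaken: "g - (C1 + C2) * riffle_error m \<le> g - C * riffle_error m" if "C \<le> C1 + C2" for C
      using that e0 by (simp add: mult_right_mono)
    have "\<exists>c<n. g - (C1 + C2) * riffle_error m \<le> coeff (shuffle_poly a n r) c"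
    proof (cases "m = 0")
      \<comment> \<open>Here \<open>g = 0\<close> because \<open>1 / sqrt 0 = 0\<close>, so
        nonnegativity of any entry is enough.\<close>
      case True
      have "0 \<le> coeff (shuffle_poly a n r) 0"
        unfolding shuffle_poly_coeff by (intro divide_nonneg_nonneg sum_nonneg digit_poly_coeff_nonneg) auto
      moreover have "g - (C1 + C2) * riffle_error m \<le> 0"
        using True C1(1) C2(1) by (simp add: g_def riffle_error_def)
      ultimately show ?thesis using r by (intro exI[of _ 0]) auto
    next
      case m0: False
      show ?thesis
      proof (cases "r \<le> n - 1 - r")
        case True
        hence m: "m = r" by (simp add: m_def)
        obtain x where x: "x \<le> r" "1 / sqrt (2 * pi * real r * (1 / real a) * (1 - 1 / real a)) - C1 * real r powr (-3/2) \<le> bin_mass r (1 / real a) x"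
          using C1(2)[of r] m m0 by auto
        have "coeff (digit_poly a n r 0) x = bin_mass r (1 / real a) x"
          by (simp add: digit_poly_def pCons_one flip: coeff_bernoulli_power)
        hence "bin_mass r (1 / real a) x / real a \<le> coeff (shuffle_poly a n r) x"
          using a by (intro ge[of 0]) auto
        moreover have "g - C1 * riffle_error m \<le> bin_mass r (1 / real a) x / real a"
          unfolding g_def m using m m0 by (intro scale[OF x(2) _ C1(1) pq(1)]) simp
        ultimately show ?thesis
          using weaken[of C1] C2(1) x(1) r by (intro exI[of _ x]) auto
      next
        case False
        define s where "s = n - 1 - r"
        have m: "m = s" using False by (simp add: m_def s_def)
        obtain x where x: "x \<le> s" "1 / sqrt (2 * pi * real s * (real (a - 1) / real a) * (1 - real (a - 1) / real a)) - C2 * real s powr (-3/2) \<le> bin_mass s (real (a - 1) / real a) x"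
          using C2(2)[of s] m m0 by auto
        have "digit_poly a n r (a - 1) = monom 1 r * [:1 - real (a - 1) / real a, real (a - 1) / real a:] ^ s"
          using a by (simp add: digit_poly_def s_def monom_altdef del: of_nat_Suc)
        hence "coeff (digit_poly a n r (a - 1)) (r + x) = bin_mass s (real (a - 1) / real a) x"
          by (simp add: coeff_monom_mult coeff_bernoulli_power)
        hence "bin_mass s (real (a - 1) / real a) x / real a \<le> coeff (shuffle_poly a n r) (r + x)"
          using a by (intro ge[of "a - 1"]) auto
        moreover have "g - C2 * riffle_error m \<le> bin_mass s (real (a - 1) / real a) x / real a"
          unfolding g_def m using m m0 by (intro scale[OF x(2) _ C2(1) pq(2)]) simp
        ultimately show ?thesis
          using weaken[of C2] C1(1) x(1) r by (intro exI[of _ "r + x"]) (auto simp: s_def)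
      qed
    qed
    thus "\<exists>c<n. 1 / sqrt (2 * pi * (real a - 1) * real (min r (n - 1 - r)))
        - (C1 + C2) * riffle_error (min r (n - 1 - r)) \<le> coeff (shuffle_poly a n r) c"
      by (simp only: g_def m_def)
  qed
qed

section \<open>Summation over the rows\<close>

text \<open>Counted from both ends, the values of the minimum are 0, 0, 1, 1, and so on. The
  induction removes the first and last row and passes to the shifted function, hence the general
  \<open>h\<close>.\<close>

lemma sum_min_reflect:
  fixes h :: "nat \<Rightarrow> 'a :: comm_monoid_add"
  shows "(\<Sum>r<n. h (min r (n - 1 - r))) = (\<Sum>l<n. h (l div 2))"
proof (induction n arbitrary: h rule: induct_nat_012)
  case (ge2 n)
  have "(\<Sum>r<Suc (Suc n). h (min r (Suc (Suc n) - 1 - r))) =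
      h 0 + ((\<Sum>r<n. h (min (Suc r) (n - r))) + h 0)"
    by (subst sum.lessThan_Suc_shift) simp
  also have "(\<Sum>r<n. h (min (Suc r) (n - r))) = (\<Sum>r<n. h (Suc (min r (n - 1 - r))))"
    by (intro sum.cong refl arg_cong[of _ _ h]) auto
  also have "\<dots> = (\<Sum>l<n. h (Suc (l div 2)))"
    by (rule ge2.IH(1))
  also have "h 0 + (\<dots> + h 0) = (\<Sum>l<Suc (Suc n). h (l div 2))"
    unfolding sum.lessThan_Suc_shift by (simp add: add_ac)
  finally show ?case .
qed simp_all

text \<open>Telescoping via \<open>(y - x) * (y + x) = 1\<close> for consecutive square roots; the
  term at 0 is 0.\<close>

lemma sum_inverse_sqrt_upper: "(\<Sum>m<Suc M. 1 / sqrt (real m)) \<le> 2 * sqrt (real M)"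
proof (induction M)
  case (Suc M)
  define x y where "x = sqrt (real M)" "y = sqrt (real (Suc M))"
  have xy: "0 \<le> x" "0 < y" "x \<le> y" "y^2 = x^2 + 1" by (auto simp: x_y_def)
  have "1 / y \<le> 2 * (y - x)"
  proof -
    have "1 = (y - x) * (y + x)" using xy by (simp add: algebra_simps power2_eq_square)
    also have "\<dots> \<le> (y - x) * (2 * y)" using xy by (intro mult_left_mono) auto
    finally show ?thesis using xy by (simp add: field_simps)
  qed
  thus ?case using Suc by (simp add: x_y_def)
qed simp

text \<open>The same telescoping from below; the loss of 2 pays for the vanishing term at 0.\<close>

lemma sum_inverse_sqrt_lower: "2 * sqrt (real M) - 2 \<le> (\<Sum>m<M. 1 / sqrt (real m))"
proof (induction M)
  case (Suc M)
  show ?case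
  proof (cases "M = 0")
    case False
    define x y where "x = sqrt (real M)" "y = sqrt (real (Suc M))"
    have xy: "0 < x" "0 < y" "x \<le> y" "y^2 = x^2 + 1" using False by (auto simp: x_y_def)
    have "2 * (y - x) \<le> 1 / x"
    proof -
      have "(y - x) * (2 * x) \<le> (y - x) * (y + x)" using xy by (intro mult_left_mono) auto
      also have "\<dots> = 1" using xy by (simp add: algebra_simps power2_eq_square)
      finally show ?thesis using xy by (simp add: field_simps)
    qed
    thus ?thesis using Suc by (simp add: x_y_def)
  qed simp
qed simp

text \<open>The sum is compared with even lengths, where the terms pair up. Of the constant 8, one
  half comes from the lower bound on the paired sum and one half from replacing
  \<open>sqrt (n / 2)\<close> by \<open>sqrt (n div 2)\<close>.\<close>

lemma sum_inverse_sqrt_half: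
  "\<bar>(\<Sum>l<n. 1 / sqrt (real (l div 2))) - 2 * sqrt 2 * sqrt (real n)\<bar> \<le> 8"
proof -
  define F where "F n = (\<Sum>l<n. 1 / sqrt (real (l div 2)))" for n
  define q where "q = n div 2"
  have F2: "F (2 * M) = 2 * (\<Sum>m<M. 1 / sqrt (real m))" for M
    by (simp add: F_def sum_lessThan_double sum_distrib_left)
  have mono: "F i \<le> F j" if "i \<le> j" for i j
    unfolding F_def using that by (intro sum_mono2) auto
  have main: "2 * sqrt 2 * sqrt (real n) = 4 * sqrt (real n / 2)"
    by (simp add: real_sqrt_divide real_div_sqrt field_simps)
  have "F n \<le> F (2 * Suc q)" by (intro mono) (simp add: q_def)
  also have "\<dots> \<le> 4 * sqrt (real q)"
    using sum_inverse_sqrt_upper[of q] by (simp only: F2)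
  also have "\<dots> \<le> 4 * sqrt (real n / 2)"
    by (auto simp: q_def)
  finally have "F n \<le> 4 * sqrt (real n / 2)" .
  moreover have "4 * sqrt (real n / 2) - 8 \<le> F n"
  proof -
    have "n \<le> 2 * q + 1" by (simp add: q_def)
    hence "real n / 2 \<le> real q + 1" by linarith
    also have "\<dots> \<le> (sqrt (real q) + 1)^2" by (simp add: power2_eq_square algebra_simps)
    finally have "sqrt (real n / 2) \<le> sqrt (real q) + 1"
      by (intro real_le_lsqrt) auto
    moreover have "4 * sqrt (real q) - 4 \<le> F (2 * q)"
      using sum_inverse_sqrt_lower[of q] by (simp add: F2)
    moreover have "F (2 * q) \<le> F n" by (intro mono) (simp add: q_def)
    ultimately show ?thesis by linarith
  qed
  ultimately show ?thesis unfolding main F_def [symmetric] by linarith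
qed

lemma sum_riffle_error_bounded:
  obtains K where "\<And>n. (\<Sum>l<n. riffle_error (l div 2)) \<le> K"
proof -
  have "summable (\<lambda>m. real m powr (-3/2))"
    by (simp add: summable_real_powr_iff)
  hence summ: "summable riffle_error"
    by (rule summable_cong[THEN iffD1, rotated])
       (auto simp: riffle_error_def eventually_at_top_linorder intro!: exI[of _ 1])
  have nonneg: "riffle_error m \<ge> 0" for m by (simp add: riffle_error_def)
  show ?thesis
  proof
    fix n
    have "(\<Sum>l<n. riffle_error (l div 2)) \<le> (\<Sum>l<2 * n. riffle_error (l div 2))"
      using nonneg by (intro sum_mono2) auto
    also have "\<dots> = 2 * (\<Sum>m<n. riffle_error m)"
      by (simp add: sum_lessThan_double sum_distrib_left)
    also have "\<dots> \<le> 2 * suminf riffle_error"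
      using summ nonneg by (intro mult_left_mono sum_le_suminf) auto
    finally show "(\<Sum>l<n. riffle_error (l div 2)) \<le> 2 * suminf riffle_error" .
  qed
qed

section \<open>The expected score as a sum of row maxima\<close>

lemma expected_score_eq:
  "expected_score k n = (\<Sum>r<n. Max (coeff (shuffle_poly (2 ^ k) n r) ` {..<n}))"
proof -
  have "(\<lambda>j. riffle_prob k n (Suc r) j) ` {1..n} = coeff (shuffle_poly (2 ^ k) n r) ` {..<n}" if "r < n" for r
  proof -
    have "{1..n} = Suc ` {..<n}" by (simp add: lessThan_atLeast0 image_Suc_atLeastLessThan atLeastLessThanSuc_atLeastAtMost)
    thus ?thesis using that by (simp add: image_image riffle_prob_def riffle_mat_power_entry)
  qed
  moreover have "expected_score k n = (\<Sum>r<n. Max ((\<lambda>j. riffle_prob k n (Suc r) j) ` {1..n}))"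
    unfolding expected_score_def using sum.atLeast1_atMost_eq[of "\<lambda>i. Max ((\<lambda>j. riffle_prob k n i j) ` {1..n})" n] by simp
  ultimately show ?thesis by (auto intro!: sum.cong)
qed

theorem theorem9:
  fixes k :: nat
  assumes "k \<ge> 1"
  shows "(\<lambda>n::nat. expected_score k n - 2 * sqrt (real n) / sqrt ((2 ^ k - 1) * pi)) \<in> O(\<lambda>_. 1)"
proof -
  define a :: nat where "a = 2 ^ k"
  have a: "2 \<le> a" using assms power_increasing[of 1 k "2::nat"] by (simp add: a_def)
  have ra: "real a = 2 ^ k" by (simp add: a_def)
  define A where "A = 1 / sqrt (2 * pi * (real a - 1))"
  have g: "1 / sqrt (2 * pi * (real a - 1) * real m) = A * (1 / sqrt (real m))" for m
    by (simp add: A_def real_sqrt_mult)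
  have A0: "A \<ge> 0" using a by (simp add: A_def)
  obtain C1 where C1: "C1 \<ge> 0"
    "\<And>n r c. 2 \<le> n \<Longrightarrow> r < n \<Longrightarrow> c < n \<Longrightarrow> coeff (shuffle_poly a n r) c \<le>
        A * (1 / sqrt (real (min r (n - 1 - r)))) + C1 * riffle_error (min r (n - 1 - r))
        + 32 * real a ^ 2 / real n"
    using shuffle_poly_upper[OF a] unfolding g by blast
  obtain C2 where C2: "C2 \<ge> 0"
    "\<And>n r. r < n \<Longrightarrow> \<exists>c<n. A * (1 / sqrt (real (min r (n - 1 - r))))
        - C2 * riffle_error (min r (n - 1 - r)) \<le> coeff (shuffle_poly a n r) c"
    using shuffle_poly_lower[OF a] unfolding g by blast
  obtain K where K: "\<And>n. (\<Sum>l<n. riffle_error (l div 2)) \<le> K"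
    using sum_riffle_error_bounded by blast
  define S where "S n = (\<Sum>l<n. 1 / sqrt (real (l div 2)))" for n
  define T where "T n = (\<Sum>l<n. riffle_error (l div 2))" for n
  have main: "2 * sqrt (real n) / sqrt ((2 ^ k - 1) * pi) = A * (2 * sqrt 2 * sqrt (real n))" for n
    by (simp add: A_def ra real_sqrt_mult)
  have S: "\<bar>A * S n - A * (2 * sqrt 2 * sqrt (real n))\<bar> \<le> A * 8" for n
    using mult_left_mono[OF sum_inverse_sqrt_half[of n] A0] A0
    by (simp add: S_def abs_mult flip: right_diff_distrib)
  have upper: "expected_score k n \<le> A * S n + C1 * K + 32 * real a ^ 2" if n: "2 \<le> n" for n
  proof -
    have "expected_score k n \<le> (\<Sum>r<n. A * (1 / sqrt (real (min r (n - 1 - r))))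
         + C1 * riffle_error (min r (n - 1 - r)) + 32 * real a ^ 2 / real n)"
      unfolding expected_score_eq a_def [symmetric]
      using C1(2)[OF n] n by (intro sum_mono Max.boundedI) (auto simp: lessThan_empty_iff)
    \<comment> \<open>The tail errors of order \<open>1 / n\<close> in the \<open>n\<close> rows add
      up to a constant.\<close>
    also have "\<dots> = (\<Sum>r<n. A * (1 / sqrt (real (min r (n - 1 - r)))) + C1 * riffle_error (min r (n - 1 - r))) + 32 * real a ^ 2"
      using n by (simp add: sum.distrib)
    also have "\<dots> = A * S n + C1 * T n + 32 * real a ^ 2"
      unfolding sum_min_reflect[where h = "\<lambda>m. A * (1 / sqrt (real m)) + C1 * riffle_error m"]
      by (simp only: sum.distrib S_def T_def sum_distrib_left)
    also have "\<dots> \<le> A * S n + C1 * K + 32 * real a ^ 2"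
      using K[of n] C1(1) by (simp add: T_def mult_left_mono)
    finally show ?thesis .
  qed
  have lower: "A * S n - C2 * K \<le> expected_score k n" for n
  proof -
    have "A * S n - C2 * K \<le> A * S n - C2 * T n"
      using K[of n] C2(1) by (simp add: T_def mult_left_mono)
    also have "\<dots> = (\<Sum>r<n. A * (1 / sqrt (real (min r (n - 1 - r)))) - C2 * riffle_error (min r (n - 1 - r)))"
      unfolding sum_min_reflect[where h = "\<lambda>m. A * (1 / sqrt (real m)) - C2 * riffle_error m"]
      by (simp only: sum_subtractf S_def T_def sum_distrib_left)
    also have "\<dots> \<le> expected_score k n"
      unfolding expected_score_eq a_def [symmetric]
    proof (rule sum_mono)
      fix r assume "r \<in> {..<n}"
      then obtain c where "c < n" "A * (1 / sqrt (real (min r (n - 1 - r)))) - C2 * riffle_error (min r (n - 1 - r)) \<le> coeff (shuffle_poly a n r) c"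
        using C2(2) by auto
      thus "A * (1 / sqrt (real (min r (n - 1 - r)))) - C2 * riffle_error (min r (n - 1 - r)) \<le> Max (coeff (shuffle_poly a n r) ` {..<n})"
        by (intro order_trans[OF _ Max_ge]) auto
    qed
    finally show ?thesis .
  qed
  have K0: "K \<ge> 0" using K[of 0] by simp
  show ?thesis
  proof (rule bigoI[where c = "A * 8 + C1 * K + C2 * K + 32 * real a ^ 2"])
    show "\<forall>\<^sub>F n in sequentially. norm (expected_score k n - 2 * sqrt (real n) / sqrt ((2 ^ k - 1) * pi))
        \<le> (A * 8 + C1 * K + C2 * K + 32 * real a ^ 2) * norm (1::real)"
    proof (rule eventually_mono[OF eventually_ge_at_top[of 2]])
      fix n :: nat assume n: "2 \<le> n"
      have "0 \<le> C1 * K" "0 \<le> C2 * K" "0 \<le> 32 * real a ^ 2" using C1(1) C2(1) K0 by auto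
      thus "norm (expected_score k n - 2 * sqrt (real n) / sqrt ((2 ^ k - 1) * pi))
        \<le> (A * 8 + C1 * K + C2 * K + 32 * real a ^ 2) * norm (1::real)"
        unfolding main real_norm_def abs_one mult_1_right using upper[OF n] lower[of n] S[of n] by linarith
    qed
  qed
qed

end
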